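(* Let $G$ be a $\sigma$-compact locally compact abelian group, $(X,G)$ a topological dynamical system, $m$ a $G$-invariant probability measure on $X$, and $\mathcal{A}$ a Følner sequence in $G$. If there exists a Wiener–Wintner point $x\in X$ of $(X,G,m)$ with respect to $\mathcal{A}$, then $m$ is ergodic.
   Context: $G$ is written additively, with a fixed Haar measure; $|A|$ is the Haar measure of $A\subseteq G$ and $dt$ denotes integration against it. $\widehat{G}$ is the dual group (continuous homomorphisms $G\to\{w\in\mathbb{C}:|w|=1\}$). A Følner sequence is a sequence $\mathcal{A}=(A_n)$ of open relatively compact subsets of $G$ (in particular $|A_n|>0$) with $\lim_n|A_n\triangle(t+A_n)|/|A_n|=0$ for all $t\in G$. A topological dynamical system $(X,G)$ is a compact Hausdorff space $X$ with a continuous action $G\times X\to X$, $(t,x)\mapsto t.x$. Measures on $X$ are regular Borel measures. $m$ is ergodic if every measurable $f:X\to\mathbb{C}$ such that for each $t\in G$ one has $f(t.\,\cdot)=f$ $m$-a.e. is constant $m$-a.e. An eigenfunction to $\chi\in\widehat{G}$ is a nonzero $f\in L^2(X,m)$ with $f(t\,\cdot)=\chi(t)f$ in $L^2(X,m)$ for all $t\in G$; together with $0$ these form the eigenspace of $\chi$. $\mathbb{S}$ is the set of $\chi\in\widehat{G}$ having an eigenfunction (eigenvalues). $\langle f,g\rangle=\int_Xf\overline{g}\,dm$. A point $x\in X$ is a Wiener–Wintner point of $(X,G,m)$ with respect to $\mathcal{A}$ if there is a set $B\subseteq\mathcal{L}^2(X,m)$ (square-integrable functions) consisting of eigenfunctions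 such that: (1) for each $\chi\in\mathbb{S}$ the set of $e\in B$ that are eigenfunctions to $\chi$ is an orthonormal basis of the eigenspace of $\chi$; (2) for all $f\in C(X)$ and $e\in B$ with corresponding eigenvalue $\chi_e$ the limit $\lim_n\frac{1}{|A_n|}\int_{A_n}f(t.x)\overline{\chi_e(t)}\,dt$ exists and equals $\langle f,e\rangle$. *)

theory Defs
  imports "HOL-Probability.Probability"
begin

definition sigma_compact :: "'a::topological_space set \<Rightarrow> bool" where
  "sigma_compact S \<longleftrightarrow> (\<exists>K :: nat \<Rightarrow> 'a set. (\<forall>n. compact (K n)) \<and> (\<Union>n. K n) = S)"

text \<open>Regularity in the sense of Radon measures (outer regular on Borel sets, inner regular on open
  sets). For finite and for sigma-finite measures, inner regularity on all Borel sets follows.\<close>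

definition regular_borel_measure :: "'a::topological_space measure \<Rightarrow> bool" where
  "regular_borel_measure M \<longleftrightarrow>
     sets M = sets borel \<and>
     (\<forall>K. compact K \<longrightarrow> emeasure M K < \<infinity>) \<and>
     (\<forall>A\<in>sets borel. emeasure M A = (INF U\<in>{U. open U \<and> A \<subseteq> U}. emeasure M U)) \<and>
     (\<forall>U. open U \<longrightarrow> emeasure M U = (SUP K\<in>{K. compact K \<and> K \<subseteq> U}. emeasure M K))"

definition haar_measure :: "'g::{topological_ab_group_add, t2_space} measure \<Rightarrow> bool" where
  "haar_measure H \<longleftrightarrow>
     regular_borel_measure H \<and> emeasure H UNIV \<noteq> 0 \<and>
     (\<forall>t. \<forall>A\<in>sets borel. emeasure H ((\<lambda>s. t + s) ` A) = emeasure H A)"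

definition dual_group :: "('g::{topological_ab_group_add, t2_space} \<Rightarrow> complex) set" where
  "dual_group = {\<xi>. continuous_on UNIV \<xi> \<and> (\<forall>t. cmod (\<xi> t) = 1) \<and> (\<forall>s t. \<xi> (s + t) = \<xi> s * \<xi> t)}"

text \<open>The sets \<open>A n\<close> are required to be nonempty, which for a Haar measure amounts to positive measure.\<close>

definition folner_sequence ::
    "'g::{topological_ab_group_add, t2_space} measure \<Rightarrow> (nat \<Rightarrow> 'g set) \<Rightarrow> bool" where
  "folner_sequence H A \<longleftrightarrow>
     (\<forall>n. open (A n) \<and> A n \<noteq> {} \<and> compact (closure (A n))) \<and>
     (\<forall>t. (\<lambda>n. measure H (sym_diff (A n) ((\<lambda>s. t + s) ` A n)) / measure H (A n)) \<longlonglongrightarrow> 0)"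

definition topological_dynamical_system ::
    "('g::{topological_ab_group_add, t2_space} \<Rightarrow> 'x::t2_space \<Rightarrow> 'x) \<Rightarrow> bool" where
  "topological_dynamical_system \<alpha> \<longleftrightarrow>
     compact (UNIV :: 'x set) \<and>
     continuous_on UNIV (\<lambda>(t, x). \<alpha> t x) \<and>
     (\<forall>x. \<alpha> 0 x = x) \<and> (\<forall>s t x. \<alpha> (s + t) x = \<alpha> s (\<alpha> t x))"

definition invariant_measure :: "('g \<Rightarrow> 'x \<Rightarrow> 'x) \<Rightarrow> 'x measure \<Rightarrow> bool" where
  "invariant_measure \<alpha> m \<longleftrightarrow> (\<forall>t. \<alpha> t \<in> measurable m m \<and> distr m m (\<alpha> t) = m)"

definition ergodic :: "('g \<Rightarrow> 'x \<Rightarrow> 'x) \<Rightarrow> 'x measure \<Rightarrow> bool" where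
  "ergodic \<alpha> m \<longleftrightarrow>
     (\<forall>f :: 'x \<Rightarrow> complex. f \<in> borel_measurable m \<longrightarrow> (\<forall>t. AE x in m. f (\<alpha> t x) = f x) \<longrightarrow>
        (\<exists>c. AE x in m. f x = c))"

text \<open>Elements of $L^2$ are represented by square-integrable functions; equality in $L^2$ is written as
  equality almost everywhere.\<close>

definition square_integrable :: "'x measure \<Rightarrow> ('x \<Rightarrow> complex) set" where
  "square_integrable m = {f \<in> borel_measurable m. integrable m (\<lambda>x. (cmod (f x))\<^sup>2)}"

definition L2_inner :: "'x measure \<Rightarrow> ('x \<Rightarrow> complex) \<Rightarrow> ('x \<Rightarrow> complex) \<Rightarrow> complex" where
  "L2_inner m f g = (\<integral>x. f x * cnj (g x) \<partial>m)"

definition L2_norm :: "'x measure \<Rightarrow> ('x \<Rightarrow> complex) \<Rightarrow> real" where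
  "L2_norm m f = sqrt (\<integral>x. (cmod (f x))\<^sup>2 \<partial>m)"

definition eigenspace ::
    "('g \<Rightarrow> 'x \<Rightarrow> 'x) \<Rightarrow> 'x measure \<Rightarrow> ('g \<Rightarrow> complex) \<Rightarrow> ('x \<Rightarrow> complex) set" where
  "eigenspace \<alpha> m \<xi> = {f \<in> square_integrable m. \<forall>t. AE x in m. f (\<alpha> t x) = \<xi> t * f x}"

definition eigenfunction ::
    "('g \<Rightarrow> 'x \<Rightarrow> 'x) \<Rightarrow> 'x measure \<Rightarrow> ('g \<Rightarrow> complex) \<Rightarrow> ('x \<Rightarrow> complex) \<Rightarrow> bool" where
  "eigenfunction \<alpha> m \<xi> f \<longleftrightarrow> f \<in> eigenspace \<alpha> m \<xi> \<and> \<not> (AE x in m. f x = 0)"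

definition eigenvalues ::
    "('g::{topological_ab_group_add, t2_space} \<Rightarrow> 'x \<Rightarrow> 'x) \<Rightarrow> 'x measure \<Rightarrow> ('g \<Rightarrow> complex) set" where
  "eigenvalues \<alpha> m = {\<xi> \<in> dual_group. \<exists>f. eigenfunction \<alpha> m \<xi> f}"

text \<open>A Hilbert space basis of \<open>V\<close>: finite linear combinations are dense in the $L^2$ norm. Distinct members of \<open>E\<close> are
  orthogonal, so \<open>E\<close> contains at most one representative of each class in $L^2$.\<close>

definition orthonormal_basis ::
    "'x measure \<Rightarrow> ('x \<Rightarrow> complex) set \<Rightarrow> ('x \<Rightarrow> complex) set \<Rightarrow> bool" where
  "orthonormal_basis m E V \<longleftrightarrow>
     E \<subseteq> V \<and>
     (\<forall>e\<in>E. \<forall>e'\<in>E. L2_inner m e e' = (if e = e' then 1 else 0)) \<and>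
     (\<forall>f\<in>V. \<forall>\<epsilon>>0. \<exists>F c. finite F \<and> F \<subseteq> E \<and> L2_norm m (\<lambda>x. f x - (\<Sum>e\<in>F. c e * e x)) < \<epsilon>)"

definition wiener_wintner_point ::
    "('g::{topological_ab_group_add, t2_space} \<Rightarrow> 'x::t2_space \<Rightarrow> 'x) \<Rightarrow> 'x measure \<Rightarrow> 'g measure \<Rightarrow>
     (nat \<Rightarrow> 'g set) \<Rightarrow> 'x \<Rightarrow> bool" where
  "wiener_wintner_point \<alpha> m H A x \<longleftrightarrow>
     (\<exists>B. (\<forall>e\<in>B. \<exists>\<xi>\<in>dual_group. eigenfunction \<alpha> m \<xi> e) \<and>
          (\<forall>\<xi>\<in>eigenvalues \<alpha> m.
             orthonormal_basis m {e \<in> B. eigenfunction \<alpha> m \<xi> e} (eigenspace \<alpha> m \<xi>)) \<and>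
          (\<forall>f :: 'x \<Rightarrow> complex. \<forall>e\<in>B. \<forall>\<xi>\<in>dual_group.
             continuous_on UNIV f \<longrightarrow> eigenfunction \<alpha> m \<xi> e \<longrightarrow>
             (\<lambda>n. (LINT t:A n|H. f (\<alpha> t x) * cnj (\<xi> t)) / complex_of_real (measure H (A n)))
               \<longlonglongrightarrow> L2_inner m f e))"

end

theory Submission
  imports Defs
begin

text \<open>
  The Wiener-Wintner condition is tested on a single continuous function, the constant \<open>1\<close>, and at
  a single eigenvalue, the trivial character. The averages of \<open>1\<close> over the sets \<open>A n\<close> are all equal
  to \<open>1\<close>, because nonempty open sets have positive Haar measure
  (\<open>haar_measure_open_pos\<close>). Hence every member \<open>e\<close> of the given basis of the space of invariant
  functions satisfies \<open>\<langle>1, e\<rangle> = 1\<close>. On a probability space both \<open>1\<close> and \<open>e\<close> are unit vectors, so this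
  is the equality case of the Cauchy-Schwarz inequality, and \<open>e = 1\<close> almost everywhere
  (\<open>AE_eq_1_if_L2_inner_eq_1\<close>).

  Linear combinations of the basis are therefore constants, so an invariant function in $L^2$ is a
  limit of constants and is itself constant (\<open>AE_const_if_approx_const\<close>). An arbitrary invariant
  measurable function is brought into $L^2$ by composing it with an injection of the plane into the
  unit disc.
\<close>

section \<open>Positivity of Haar measure on open sets\<close>

text \<open>Finitely many translates of \<open>U\<close> cover any given compact set. If \<open>U\<close> were null, all compact sets
  would be null, and by inner regularity so would be the whole group.\<close>

lemma haar_measure_open_pos:
  fixes H :: "'g::{topological_ab_group_add, t2_space} measure"
  assumes H: "haar_measure H" and U: "open U" "U \<noteq> {}"
  shows "emeasure H U \<noteq> 0"
proof
  assume U0: "emeasure H U = 0"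
  have reg: "regular_borel_measure H"
    and inv: "\<And>t A. A \<in> sets borel \<Longrightarrow> emeasure H ((\<lambda>s. t + s) ` A) = emeasure H A"
    and pos: "emeasure H UNIV \<noteq> 0"
    using H by (auto simp: haar_measure_def)
  have sets_H: "sets H = sets borel"
    and inner: "emeasure H UNIV = (SUP K\<in>{K. compact K \<and> K \<subseteq> UNIV}. emeasure H K)"
    using reg by (auto simp: regular_borel_measure_def)
  have open_translate: "open ((\<lambda>s. t + s) ` U)" for t
  proof -
    have "(\<lambda>s. t + s) ` U = (\<lambda>s. s - t) -` U"
    proof (intro equalityI subsetI)
      fix s
      assume "s \<in> (\<lambda>s. s - t) -` U"
      then show "s \<in> (\<lambda>s. t + s) ` U"
        by (intro image_eqI[of _ _ "s - t"]) auto
    qed auto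
    then show ?thesis
      using U(1) by (auto intro!: open_vimage continuous_intros)
  qed
  have "emeasure H K = 0" if K: "compact K" for K
  proof -
    obtain u where u: "u \<in> U"
      using U(2) by auto
    have cover: "K \<subseteq> (\<Union>t\<in>UNIV. (\<lambda>s. t + s) ` U)"
    proof
      fix k
      have "k = (k - u) + u"
        by simp
      then show "k \<in> (\<Union>t\<in>UNIV. (\<lambda>s. t + s) ` U)"
        using u by blast
    qed
    obtain T where T: "finite T" "K \<subseteq> (\<Union>t\<in>T. (\<lambda>s. t + s) ` U)"
      by (rule compactE_image[OF K open_translate cover])
    have null: "(\<lambda>s. t + s) ` U \<in> null_sets H" for t
      using inv[of U t] U(1) U0 open_translate[of t] sets_H by (auto simp: null_sets_def)
    have "(\<Union>t\<in>T. (\<lambda>s. t + s) ` U) \<in> null_sets H"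
      using T(1) null by (intro null_sets.finite_UN) auto
    then show ?thesis
      using T(2) by (metis emeasure_mono le_zero_eq null_setsD1 null_setsD2)
  qed
  then have "emeasure H UNIV = 0"
    unfolding inner by (intro antisym SUP_least) auto
  with pos show False
    by simp
qed

section \<open>Distance to the constants in $L^2$\<close>

lemma (in prob_space) square_integrable_imp_integrable_complex:
  assumes "f \<in> square_integrable M"
  shows "integrable M f"
proof (rule Bochner_Integration.integrable_bound)
  show "integrable M (\<lambda>x. 1 + (cmod (f x))\<^sup>2)"
    using assms by (auto simp: square_integrable_def)
  show "AE x in M. norm (f x) \<le> norm (1 + (cmod (f x))\<^sup>2)"
  proof (rule AE_I2)
    fix x
    have "0 \<le> (cmod (f x) - 1/2)\<^sup>2"
      by simp
    then show "norm (f x) \<le> norm (1 + (cmod (f x))\<^sup>2)"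
      by (simp add: power2_eq_square algebra_simps)
  qed
qed (use assms in \<open>auto simp: square_integrable_def\<close>)

text \<open>Completing the square around the mean: the mean is the nearest constant in $L^2$, and the second
  summand is the price of any other constant.\<close>

lemma (in prob_space) integral_norm_diff_const:
  fixes f :: "'a \<Rightarrow> complex"
  assumes f: "f \<in> square_integrable M"
  shows "integrable M (\<lambda>x. (cmod (f x - a))\<^sup>2)"
    and "(\<integral>x. (cmod (f x - a))\<^sup>2 \<partial>M) =
      (\<integral>x. (cmod (f x))\<^sup>2 \<partial>M) - (cmod (\<integral>x. f x \<partial>M))\<^sup>2 + (cmod ((\<integral>x. f x \<partial>M) - a))\<^sup>2"
proof -
  have expand: "(cmod (z - a))\<^sup>2 = (cmod z)\<^sup>2 - 2 * Re (cnj a * z) + (cmod a)\<^sup>2" for z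
    unfolding cmod_power2 by (simp add: power2_eq_square algebra_simps)
  have int: "integrable M f"
    by (rule square_integrable_imp_integrable_complex[OF f])
  have int2: "integrable M (\<lambda>x. (cmod (f x))\<^sup>2)"
    using f by (simp add: square_integrable_def)
  have int_Re: "integrable M (\<lambda>x. Re (cnj a * f x))"
    using int by (intro integrable_Re integrable_mult_right) auto
  show "integrable M (\<lambda>x. (cmod (f x - a))\<^sup>2)"
    unfolding expand using int2 int_Re
    by (intro Bochner_Integration.integrable_add Bochner_Integration.integrable_diff
        integrable_mult_right) simp_all
  have mean_Re: "(\<integral>x. Re (cnj a * f x) \<partial>M) = Re (cnj a * (\<integral>x. f x \<partial>M))"
    using int by (subst integral_Re) auto
  have split: "(\<integral>x. (cmod (f x))\<^sup>2 - 2 * r x + (cmod a)\<^sup>2 \<partial>M) =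
      (\<integral>x. (cmod (f x))\<^sup>2 \<partial>M) - 2 * (\<integral>x. r x \<partial>M) + (cmod a)\<^sup>2"
    if "integrable M r" for r
    using int2 that by (simp add: prob_space)
  have "(\<integral>x. (cmod (f x - a))\<^sup>2 \<partial>M) =
      (\<integral>x. (cmod (f x))\<^sup>2 \<partial>M) - 2 * Re (cnj a * (\<integral>x. f x \<partial>M)) + (cmod a)\<^sup>2"
    unfolding expand split[OF int_Re] mean_Re ..
  then show "(\<integral>x. (cmod (f x - a))\<^sup>2 \<partial>M) =
      (\<integral>x. (cmod (f x))\<^sup>2 \<partial>M) - (cmod (\<integral>x. f x \<partial>M))\<^sup>2 + (cmod ((\<integral>x. f x \<partial>M) - a))\<^sup>2"
    unfolding expand by simp
qed

lemma (in prob_space) AE_eq_const_if_L2_dist_0: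
  fixes f :: "'a \<Rightarrow> complex"
  assumes f: "f \<in> square_integrable M" and "(\<integral>x. (cmod (f x - a))\<^sup>2 \<partial>M) = 0"
  shows "AE x in M. f x = a"
  using integral_nonneg_eq_0_iff_AE[OF integral_norm_diff_const(1)[OF f, of a]] assms(2) by simp

text \<open>The equality case of the Cauchy-Schwarz inequality for the unit vectors \<open>1\<close> and \<open>e\<close>.\<close>

lemma (in prob_space) AE_eq_1_if_L2_inner_eq_1:
  assumes e: "e \<in> square_integrable M"
    and "L2_inner M e e = 1" and "L2_inner M (\<lambda>_. 1) e = 1"
  shows "AE x in M. e x = 1"
proof (rule AE_eq_const_if_L2_dist_0[OF e])
  have "complex_of_real (\<integral>x. (cmod (e x))\<^sup>2 \<partial>M) = L2_inner M e e"
    unfolding L2_inner_def integral_complex_of_real[symmetric]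
    by (simp only: complex_norm_square)
  with assms(2) have norm: "(\<integral>x. (cmod (e x))\<^sup>2 \<partial>M) = 1"
    using of_real_eq_1_iff by metis
  have "cnj (\<integral>x. e x \<partial>M) = 1"
    using assms(3) by (simp add: L2_inner_def)
  then have "(\<integral>x. e x \<partial>M) = 1"
    by (metis complex_cnj_cnj complex_cnj_one)
  with norm show "(\<integral>x. (cmod (e x - 1))\<^sup>2 \<partial>M) = 0"
    by (simp add: integral_norm_diff_const(2)[OF e])
qed

text \<open>The constants form a closed subspace of $L^2$: a good approximation by some constant forces the
  variance to be small.\<close>

lemma (in prob_space) AE_const_if_approx_const:
  assumes f: "f \<in> square_integrable M"
    and approx: "\<And>\<epsilon>. \<epsilon> > 0 \<Longrightarrow> \<exists>a. L2_norm M (\<lambda>x. f x - a) < \<epsilon>"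
  shows "AE x in M. f x = (\<integral>x. f x \<partial>M)"
proof (rule AE_eq_const_if_L2_dist_0[OF f])
  let ?V = "\<integral>x. (cmod (f x - (\<integral>x. f x \<partial>M)))\<^sup>2 \<partial>M"
  have "sqrt ?V \<le> 0 + \<epsilon>" if pos: "\<epsilon> > 0" for \<epsilon>
  proof -
    obtain a where a: "L2_norm M (\<lambda>x. f x - a) < \<epsilon>"
      using approx[OF pos] by blast
    have "?V \<le> (\<integral>x. (cmod (f x - a))\<^sup>2 \<partial>M)"
      unfolding integral_norm_diff_const(2)[OF f] by simp
    then have "sqrt ?V \<le> L2_norm M (\<lambda>x. f x - a)"
      unfolding L2_norm_def by (rule real_sqrt_le_mono)
    with a show ?thesis
      by simp
  qed
  then have "sqrt ?V \<le> 0"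
    by (rule field_le_epsilon)
  then have "?V \<le> 0"
    by simp
  moreover have "?V \<ge> 0"
    by (rule integral_nonneg_AE) simp
  ultimately show "?V = 0"
    by (rule antisym)
qed

section \<open>Ergodicity\<close>

lemma eigenfunction_1_const:
  assumes "prob_space m"
  shows "eigenfunction \<alpha> m (\<lambda>_. 1) (\<lambda>_. 1)"
proof -
  interpret prob_space m by fact
  show ?thesis
    by (simp add: eigenfunction_def eigenspace_def square_integrable_def)
qed

text \<open>It suffices to test ergodicity on $L^2$: the map \<open>z \<mapsto> z / (1 + \<bar>z\<bar>)\<close> is injective with values in
  the unit disc, and \<open>w \<mapsto> w / (1 - \<bar>w\<bar>)\<close> undoes it.\<close>

lemma ergodic_if_eigenspace_1_const:
  fixes \<alpha> :: "'g \<Rightarrow> 'x \<Rightarrow> 'x"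
  assumes "prob_space m"
    and const: "\<And>f. f \<in> eigenspace \<alpha> m (\<lambda>_. 1) \<Longrightarrow> \<exists>c. AE x in m. f x = c"
  shows "ergodic \<alpha> m"
  unfolding ergodic_def
proof (intro allI impI)
  interpret prob_space m by fact
  fix f :: "'x \<Rightarrow> complex"
  assume meas[measurable]: "f \<in> borel_measurable m" and inv: "\<forall>t. AE x in m. f (\<alpha> t x) = f x"
  define g where "g x = f x / complex_of_real (1 + cmod (f x))" for x
  have norm_g: "cmod (g x) = cmod (f x) / (1 + cmod (f x))" for x
    unfolding g_def by (simp only: norm_divide norm_of_real) simp
  have g_meas[measurable]: "g \<in> borel_measurable m"
    unfolding g_def by measurable
  have "cmod (g x) \<le> 1" for x
    unfolding norm_g by (simp add: divide_le_eq_1 add_pos_nonneg)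
  then have "integrable m (\<lambda>x. (cmod (g x))\<^sup>2)"
    by (intro integrable_const_bound[where B = 1]) (auto simp: power_le_one)
  then have "g \<in> square_integrable m"
    by (simp add: square_integrable_def)
  moreover have "AE x in m. g (\<alpha> t x) = 1 * g x" for t
    using inv[rule_format, of t] by eventually_elim (simp add: g_def)
  ultimately obtain c where c: "AE x in m. g x = c"
    using const[of g] by (auto simp: eigenspace_def)
  have "f x = g x / complex_of_real (1 - cmod (g x))" for x
  proof -
    have pos: "1 + cmod (f x) > 0"
      by (simp add: add_pos_nonneg)
    then have "1 - cmod (g x) = 1 / (1 + cmod (f x))"
      unfolding norm_g by (simp add: field_simps)
    then show ?thesis
      unfolding g_def using pos by (simp del: of_real_add)
  qed
  then have "AE x in m. f x = c / complex_of_real (1 - cmod c)"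
    using c by (auto elim: eventually_mono)
  then show "\<exists>c. AE x in m. f x = c" ..
qed

theorem proposition5p3:
  fixes H :: "'g::{topological_ab_group_add, t2_space} measure"
    and \<alpha> :: "'g \<Rightarrow> 'x::t2_space \<Rightarrow> 'x"
    and m :: "'x measure"
    and A :: "nat \<Rightarrow> 'g set"
  assumes "locally compact (UNIV :: 'g set)"
    and "sigma_compact (UNIV :: 'g set)"
    and "haar_measure H"
    and "topological_dynamical_system \<alpha>"
    and "regular_borel_measure m"
    and "prob_space m"
    and "invariant_measure \<alpha> m"
    and "folner_sequence H A"
    and "\<exists>x. wiener_wintner_point \<alpha> m H A x"
  shows "ergodic \<alpha> m"
proof (rule ergodic_if_eigenspace_1_const[OF \<open>prob_space m\<close>])
  interpret prob_space m by fact
  let ?triv = "\<lambda>_ :: 'g. 1 :: complex"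
  have dual: "?triv \<in> dual_group"
    by (simp add: dual_group_def)
  then have eigenvalue: "?triv \<in> eigenvalues \<alpha> m"
    using eigenfunction_1_const[OF \<open>prob_space m\<close>] by (auto simp: eigenvalues_def)
  obtain x B where
    basis: "orthonormal_basis m {e \<in> B. eigenfunction \<alpha> m ?triv e} (eigenspace \<alpha> m ?triv)" and
    lim: "\<And>f e. e \<in> B \<Longrightarrow> continuous_on UNIV f \<Longrightarrow> eigenfunction \<alpha> m ?triv e \<Longrightarrow>
        (\<lambda>n. (LINT t:A n|H. f (\<alpha> t x) * cnj (?triv t)) / complex_of_real (measure H (A n)))
          \<longlonglongrightarrow> L2_inner m f e"
    using assms(9) dual eigenvalue unfolding wiener_wintner_point_def by blast

  have sets_H: "sets H = sets borel"
    and H_compact: "\<And>K. compact K \<Longrightarrow> emeasure H K < \<infinity>"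
    using \<open>haar_measure H\<close> by (auto simp: haar_measure_def regular_borel_measure_def)
  then have space_H: "space H = UNIV"
    by (metis sets_eq_imp_space_eq space_borel)
  have A: "open (A n)" "A n \<noteq> {}" "compact (closure (A n))" for n
    using \<open>folner_sequence H A\<close> by (auto simp: folner_sequence_def)
  have average_1: "(LINT t:A n|H. 1 * cnj (?triv t)) / complex_of_real (measure H (A n)) = 1" for n
  proof -
    have "emeasure H (A n) \<le> emeasure H (closure (A n))"
      using sets_H by (intro emeasure_mono closure_subset) auto
    then have fin: "emeasure H (A n) < \<infinity>"
      using H_compact[OF A(3)[of n]] by (rule le_less_trans)
    then have "measure H (A n) \<noteq> 0"
      using haar_measure_open_pos[OF \<open>haar_measure H\<close> A(1,2)[of n]]
      by (auto simp: measure_def enn2real_eq_0_iff)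
    moreover have "(LINT t:A n|H. (1 :: complex)) = complex_of_real (measure H (A n))"
      using fin sets_H A(1)[of n] set_integral_const[of "A n" H "1 :: complex"]
      by (simp add: scaleR_conv_of_real less_top)
    ultimately show ?thesis
      by simp
  qed

  have e_1: "AE y in m. e y = 1" if e: "e \<in> B" "eigenfunction \<alpha> m ?triv e" for e
  proof (rule AE_eq_1_if_L2_inner_eq_1)
    show "e \<in> square_integrable m"
      using e(2) by (simp add: eigenfunction_def eigenspace_def)
    show "L2_inner m e e = 1"
      using basis e by (simp add: orthonormal_basis_def)
    show "L2_inner m (\<lambda>_. 1) e = 1"
      using lim[OF e(1) _ e(2), of "\<lambda>_. 1"] unfolding average_1
      by (simp add: LIMSEQ_const_iff)
  qed

  fix f
  assume f: "f \<in> eigenspace \<alpha> m ?triv"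
  have "AE y in m. f y = (\<integral>y. f y \<partial>m)"
  proof (rule AE_const_if_approx_const)
    show f_sq: "f \<in> square_integrable m"
      using f by (simp add: eigenspace_def)
    fix \<epsilon> :: real
    assume "\<epsilon> > 0"
    then obtain F c where F: "finite F" "F \<subseteq> {e \<in> B. eigenfunction \<alpha> m ?triv e}"
      and less: "L2_norm m (\<lambda>y. f y - (\<Sum>e\<in>F. c e * e y)) < \<epsilon>"
      using basis f unfolding orthonormal_basis_def by blast
    have "AE y in m. \<forall>e\<in>F. e y = 1"
      using F e_1 by (intro AE_finite_allI) auto
    then have "AE y in m. (cmod (f y - (\<Sum>e\<in>F. c e * e y)))\<^sup>2 = (cmod (f y - (\<Sum>e\<in>F. c e)))\<^sup>2"
    proof eventually_elim
      case (elim y)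
      then have "(\<Sum>e\<in>F. c e * e y) = (\<Sum>e\<in>F. c e)"
        by (intro sum.cong refl) (metis mult.right_neutral)
      then show ?case
        by simp
    qed
    moreover have "e \<in> borel_measurable m" if "e \<in> F" for e
      using F(2) that by (auto simp: eigenfunction_def eigenspace_def square_integrable_def)
    moreover have "f \<in> borel_measurable m"
      using f_sq by (simp add: square_integrable_def)
    ultimately have "L2_norm m (\<lambda>y. f y - (\<Sum>e\<in>F. c e * e y)) = L2_norm m (\<lambda>y. f y - (\<Sum>e\<in>F. c e))"
      unfolding L2_norm_def by (intro arg_cong[where f = sqrt] integral_cong_AE) auto
    with less show "\<exists>a. L2_norm m (\<lambda>y. f y - a) < \<epsilon>"
      by auto
  qed
  then show "\<exists>c. AE y in m. f y = c" ..
qed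

end
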